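(* Let $T$ be a Tanner graph without $4$-cycles in which every v-node has degree $\gamma$ (column weight $\gamma\ge 1$). Consider an $(a,b)$ elementary trapping set of $T$ in which all $8$-cycles are chordless, and let $E$ be the edge set of its VN graph. Then: (i) $|E|\le \frac{a^3}{4a-3}$; (ii) $b\ge a\gamma-\frac{2a^3}{4a-3}$, and if $b<a$, then $a\ge 2\gamma-2$.
   Context: A Tanner graph is the simple bipartite graph of a binary parity-check matrix, with variable-nodes (v-nodes, one per column) and check-nodes (c-nodes, one per row), adjacent iff the corresponding entry is $1$. An $(a,b)$ trapping set is a set of $a\ge1$ v-nodes such that, in the subgraph induced by these v-nodes and all c-nodes adjacent to at least one of them, exactly $b$ c-nodes have odd degree. It is elementary (an ETS) if every c-node of this induced subgraph has degree $1$ or $2$. The VN graph of an ETS is the graph whose vertices are the v-nodes of the ETS and whose edges are the degree-$2$ c-nodes of the induced subgraph, each joining its two neighbouring v-nodes (degree-$1$ c-nodes are removed). A cycle $C$ is chordless if no c-node outside $C$ is adjacent to two distinct v-nodes of $C$ and no edge not in $C$ joins a v-node of $C$ to a c-node of $C$; otherwise it is a cycle with a chord. *)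

theory Defs
  imports "HOL-Analysis.Finite_Cartesian_Product" "HOL-Library.Z2"
begin

text \<open>Undirected simple graphs; an edge is the two-element set of its ends.\<close>

record 'a ugraph =
  verts :: "'a set"
  edges :: "'a set set"

definition induced_subgraph :: "'a ugraph \<Rightarrow> 'a set \<Rightarrow> 'a ugraph" where
  "induced_subgraph G W = \<lparr>verts = verts G \<inter> W, edges = {e \<in> edges G. e \<subseteq> W}\<rparr>"

definition degree :: "'a ugraph \<Rightarrow> 'a \<Rightarrow> nat" where
  "degree G x = card {e \<in> edges G. x \<in> e}"

text \<open>A cycle is given by the list of its vertices in cyclic order, without repeating the first
  one at the end, so the length of the list is the length of the cycle.\<close>

definition cycle_edges :: "'a list \<Rightarrow> 'a set set" where
  "cycle_edges C = {{C ! i, C ! (Suc i mod length C)} |i. i < length C}"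

definition is_cycle :: "'a ugraph \<Rightarrow> 'a list \<Rightarrow> bool" where
  "is_cycle G C \<longleftrightarrow>
     3 \<le> length C \<and> distinct C \<and> set C \<subseteq> verts G \<and> cycle_edges C \<subseteq> edges G"

datatype ('v, 'c) node = VNode 'v | CNode 'c

definition tanner_graph :: "bit ^ 'n ^ 'm \<Rightarrow> ('n, 'm) node ugraph" where
  "tanner_graph H =
     \<lparr>verts = UNIV, edges = {{VNode v, CNode c} |v c. H $ c $ v = 1}\<rparr>"

definition chordless :: "('v, 'c) node ugraph \<Rightarrow> ('v, 'c) node list \<Rightarrow> bool" where
  "chordless G C \<longleftrightarrow>
     (\<forall>c v w. CNode c \<in> verts G \<and> CNode c \<notin> set C \<and>
        VNode v \<in> set C \<and> VNode w \<in> set C \<and> v \<noteq> w \<longrightarrow>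
        \<not> ({VNode v, CNode c} \<in> edges G \<and> {VNode w, CNode c} \<in> edges G)) \<and>
     (\<forall>v c. VNode v \<in> set C \<and> CNode c \<in> set C \<and> {VNode v, CNode c} \<in> edges G \<longrightarrow>
        {VNode v, CNode c} \<in> cycle_edges C)"

definition ts_subgraph :: "('v, 'c) node ugraph \<Rightarrow> 'v set \<Rightarrow> ('v, 'c) node ugraph" where
  "ts_subgraph T S =
     induced_subgraph T (VNode ` S \<union> {CNode c |c. \<exists>v\<in>S. {VNode v, CNode c} \<in> edges T})"

definition trapping_set :: "('v, 'c) node ugraph \<Rightarrow> nat \<Rightarrow> nat \<Rightarrow> 'v set \<Rightarrow> bool" where
  "trapping_set T a b S \<longleftrightarrow>
     VNode ` S \<subseteq> verts T \<and> finite S \<and> card S = a \<and> 1 \<le> a \<and>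
     card {c. CNode c \<in> verts (ts_subgraph T S) \<and> odd (degree (ts_subgraph T S) (CNode c))} = b"

definition elementary_trapping_set ::
    "('v, 'c) node ugraph \<Rightarrow> nat \<Rightarrow> nat \<Rightarrow> 'v set \<Rightarrow> bool" where
  "elementary_trapping_set T a b S \<longleftrightarrow>
     trapping_set T a b S \<and>
     (\<forall>c. CNode c \<in> verts (ts_subgraph T S) \<longrightarrow> degree (ts_subgraph T S) (CNode c) \<in> {1, 2})"

text \<open>The edges of the VN graph are check nodes, so it is a multigraph a priori: distinct edges
  may have the same set of ends.\<close>

record ('v, 'e) multigraph =
  mverts :: "'v set"
  medges :: "'e set"
  mends :: "'e \<Rightarrow> 'v set"

definition vn_graph :: "('v, 'c) node ugraph \<Rightarrow> 'v set \<Rightarrow> ('v, 'c) multigraph" where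
  "vn_graph T S =
     \<lparr>mverts = S,
      medges = {c. CNode c \<in> verts (ts_subgraph T S) \<and> degree (ts_subgraph T S) (CNode c) = 2},
      mends = (\<lambda>c. {v \<in> S. {VNode v, CNode c} \<in> edges (ts_subgraph T S)})\<rparr>"

end

theory Submission
  imports Defs
begin

text \<open>Without 4-cycles the VN graph is simple, and an 8-cycle of the trapping set with a chord is
  the same as a 4-cycle of the VN graph with a diagonal. So the VN graph contains no diamond (two
  triangles with a common edge), and every vertex outside a triangle has at most one neighbour on
  it. Deleting the vertices of a triangle, and falling back on Mantel's theorem if there is none,
  one gets by induction \<open>4 |E| \<le> a\<^sup>2\<close>, except that a triangle itself has \<open>|E| = a = 3\<close>. The bounds
  on \<open>b\<close> follow from the double counting identity \<open>a \<gamma> = 2 |E| + b\<close>.\<close>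

section \<open>Graphs without diamonds\<close>

text \<open>An edge avoids \<open>K\<close>, lies inside \<open>K\<close>, or crosses; by
  \<open>unique\<close>, each vertex outside \<open>K\<close> accounts for at most one crossing
  edge. Applied with \<open>K\<close> an edge and with \<open>K\<close> a triangle.\<close>

lemma card_edges_delete_le:
  assumes "finite V" and E: "\<And>e. e \<in> E \<Longrightarrow> e \<subseteq> V \<and> card e = 2" and "K \<subseteq> V"
    and unique: "\<And>w x y. w \<in> V - K \<Longrightarrow> x \<in> K \<Longrightarrow> y \<in> K \<Longrightarrow> {w, x} \<in> E \<Longrightarrow> {w, y} \<in> E \<Longrightarrow> x = y"
  shows "card E \<le> card {e \<in> E. e \<subseteq> V - K} + (card K choose 2) + card (V - K)"
proof -
  let ?A = "{e \<in> E. e \<subseteq> V - K}" and ?B = "{e. e \<subseteq> K \<and> card e = 2}"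
  \<comment> \<open>A vertex \<open>w\<close> without a neighbour in \<open>K\<close> contributes an
    unspecified set here. This is harmless: \<open>?C\<close> only has to cover the crossing edges
    and have at most \<open>card (V - K)\<close> elements.\<close>
  let ?C = "(\<lambda>w. {w, THE x. x \<in> K \<and> {w, x} \<in> E}) ` (V - K)"
  have finK: "finite K" using assms(1,3) finite_subset by blast
  have finA: "finite ?A" using E assms(1)
    by (intro finite_subset[of ?A "Pow V"]) auto
  have "E \<subseteq> ?A \<union> ?B \<union> ?C"
  proof
    fix e assume e: "e \<in> E"
    obtain x y where xy: "e = {x, y}" "x \<noteq> y" using E[OF e] by (auto simp: card_2_iff)
    have crossing: "{w, z} \<in> ?C" if "w \<in> V - K" "z \<in> K" "{w, z} \<in> E" for w z
    proof -
      have "(THE x. x \<in> K \<and> {w, x} \<in> E) = z"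
        using that unique by (intro the_equality) blast+
      then show ?thesis using that(1) by (intro image_eqI[of _ _ w]) auto
    qed
    consider "x \<in> K" "y \<in> K" | "x \<notin> K" "y \<notin> K" | "x \<notin> K" "y \<in> K" | "x \<in> K" "y \<notin> K" by blast
    then show "e \<in> ?A \<union> ?B \<union> ?C"
    proof cases
      case 1 then show ?thesis using xy by simp
    next
      case 2 then show ?thesis using xy e E[OF e] by blast
    next
      case 3 then show ?thesis using xy e E[OF e] crossing[of x y] by blast
    next
      case 4 then show ?thesis using xy e E[OF e] crossing[of y x] by (simp add: insert_commute)
    qed
  qed
  then have "card E \<le> card (?A \<union> ?B \<union> ?C)"
    using finA finK assms(1) by (intro card_mono) auto
  also have "\<dots> \<le> card ?A + card ?B + card ?C"
    using card_Un_le[of "?A \<union> ?B" ?C] card_Un_le[of ?A ?B] by linarith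
  also have "card ?B = card K choose 2" using finK by (rule n_subsets)
  also have "card ?C \<le> card (V - K)" using assms(1) by (intro card_image_le) auto
  finally show ?thesis by simp
qed

text \<open>Delete both ends of an edge: a vertex adjacent to both would give a triangle, so at most
  \<open>1 + m\<close> edges disappear, and m^2 + 4 + 4m = (m + 2)^2.\<close>

lemma mantel:
  assumes "finite V" and "\<And>e. e \<in> E \<Longrightarrow> e \<subseteq> V \<and> card e = 2"
    and "\<And>x y z. {x, y} \<in> E \<Longrightarrow> {y, z} \<in> E \<Longrightarrow> {x, z} \<in> E \<Longrightarrow> False"
  shows "4 * card E \<le> card V ^ 2"
  using assms
proof (induction "card V" arbitrary: V E rule: less_induct)
  case less
  show ?case
  proof (cases "E = {}")
    case False
    then obtain e where e: "e \<in> E" by blast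
    then obtain u v where uv: "e = {u, v}" "u \<noteq> v" using less.prems(2)[OF e] by (auto simp: card_2_iff)
    have eV: "e \<subseteq> V" "card e = 2" using less.prems(2)[OF e] by auto
    define m where "m = card (V - e)"
    have card: "card V = m + 2"
      using eV less.prems(1) card_mono[OF less.prems(1) eV(1)]
      by (simp add: m_def card_Diff_subset finite_subset)
    have "card E \<le> card {f \<in> E. f \<subseteq> V - e} + (card e choose 2) + card (V - e)"
    proof (rule card_edges_delete_le[OF less.prems(1,2) eV(1)])
      fix w x y assume w: "w \<in> V - e" "x \<in> e" "y \<in> e" "{w, x} \<in> E" "{w, y} \<in> E"
      show "x = y"
      proof (rule ccontr)
        assume "x \<noteq> y"
        then have "{x, y} = e" using w uv by auto
        then show False using less.prems(3)[of w x y] w e by simp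
      qed
    qed
    moreover have "4 * card {f \<in> E. f \<subseteq> V - e} \<le> card (V - e) ^ 2"
    proof (rule less.hyps)
      show "card (V - e) < card V" using card m_def by simp
    qed (use less.prems in auto)
    ultimately show ?thesis
      using eV(2) unfolding card m_def[symmetric] by (simp add: power2_eq_square)
  qed simp
qed

text \<open>A vertex adjacent to two corners of a triangle forms a diamond with the third corner, so
  deleting a triangle removes at most \<open>3 + m\<close> edges. The extra term covers a single
  triangle, where 4 * 3 = 3^2 + 3.\<close>

lemma card_edges_diamond_free:
  assumes "finite V" and "\<And>e. e \<in> E \<Longrightarrow> e \<subseteq> V \<and> card e = 2"
    and "\<And>w x y z. w \<noteq> z \<Longrightarrow> {x, y} \<in> E \<Longrightarrow> {w, x} \<in> E \<Longrightarrow> {w, y} \<in> E \<Longrightarrow>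
           {z, x} \<in> E \<Longrightarrow> {z, y} \<in> E \<Longrightarrow> False"
  shows "4 * card E \<le> card V ^ 2 + (if card V = 3 then 3 else 0)"
  using assms
proof (induction "card V" arbitrary: V E rule: less_induct)
  case less
  show ?case
  proof (cases "\<exists>x y z. {x, y} \<in> E \<and> {y, z} \<in> E \<and> {x, z} \<in> E")
    case False
    then have "4 * card E \<le> card V ^ 2" using less.prems by (intro mantel) blast+
    then show ?thesis by simp
  next
    case True
    then obtain p q r where pqr: "{p, q} \<in> E" "{q, r} \<in> E" "{p, r} \<in> E" by blast
    define K where "K = {p, q, r}"
    have dist: "p \<noteq> q" "q \<noteq> r" "p \<noteq> r"
      using less.prems(2)[OF pqr(1)] less.prems(2)[OF pqr(2)] less.prems(2)[OF pqr(3)] by auto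
    have K: "K \<subseteq> V" "card K = 3"
      using dist less.prems(2)[OF pqr(1)] less.prems(2)[OF pqr(2)] by (auto simp: K_def)
    define m where "m = card (V - K)"
    define k where "k = card {f \<in> E. f \<subseteq> V - K}"
    have card: "card V = m + 3"
      using K less.prems(1) card_mono[OF less.prems(1) K(1)]
      by (simp add: m_def card_Diff_subset finite_subset)
    have "card E \<le> k + (card K choose 2) + m"
      unfolding k_def m_def
    proof (rule card_edges_delete_le[OF less.prems(1,2) K(1)])
      fix w x y assume w: "w \<in> V - K" "x \<in> K" "y \<in> K" "{w, x} \<in> E" "{w, y} \<in> E"
      show "x = y"
      proof (rule ccontr)
        assume "x \<noteq> y"
        have "{p, q, r} - {x, y} \<noteq> {}" using dist by auto
        then obtain z where z: "z \<in> K" "z \<noteq> x" "z \<noteq> y" unfolding K_def by blast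
        have edge: "{s, t} \<in> E" if "s \<in> K" "t \<in> K" "s \<noteq> t" for s t
          using that pqr unfolding K_def by (elim insertE emptyE) (simp_all add: insert_commute)
        have "{x, y} \<in> E" "{z, x} \<in> E" "{z, y} \<in> E"
          using edge w(2,3) z \<open>x \<noteq> y\<close> by auto
        then show False using less.prems(3)[of w z x y] w z(1) by blast
      qed
    qed
    then have le: "card E \<le> k + 3 + m" using K(2) by (simp add: choose_two)
    have IH: "4 * k \<le> m ^ 2 + (if m = 3 then 3 else 0)"
      unfolding k_def m_def
    proof (rule less.hyps)
      show "card (V - K) < card V" using card m_def by simp
    next
      fix w x y z
      assume "w \<noteq> z" "{x, y} \<in> {f \<in> E. f \<subseteq> V - K}" "{w, x} \<in> {f \<in> E. f \<subseteq> V - K}"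
        "{w, y} \<in> {f \<in> E. f \<subseteq> V - K}" "{z, x} \<in> {f \<in> E. f \<subseteq> V - K}" "{z, y} \<in> {f \<in> E. f \<subseteq> V - K}"
      then show False using less.prems(3)[of w z x y] by simp
    qed (use less.prems in auto)
    \<comment> \<open>In general m^2 + 12 + 4m \<le> (m + 3)^2 needs 2m \<ge> 3. For m = 0 the
      exceptional term helps; for m = 1 integrality forces k = 0; for m = 3 the exceptional term of
      the induction hypothesis still fits, with equality at 36.\<close>
    consider "m = 0" | "m = 1" | "m = 2" | "m = 3" | "m \<ge> 4" by linarith
    then show ?thesis
      using le IH unfolding card by cases (auto simp: power2_eq_square algebra_simps)
  qed
qed

section \<open>The VN graph of an elementary trapping set\<close>

text \<open>This is the set of ends of \<open>c\<close> in the VN graph when it has two elements,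
  and it is empty exactly when \<open>c\<close> lies outside the induced subgraph.\<close>

definition nbrs :: "bit ^ 'n ^ 'm \<Rightarrow> 'n set \<Rightarrow> 'm \<Rightarrow> 'n set" where
  "nbrs H S c = {v \<in> S. H $ c $ v = 1}"

lemma finite_nbrs [simp]: "finite (nbrs H S c)"
  by (rule finite_subset[of _ UNIV]) auto

section \<open>Adjacency and degrees in the Tanner graph and the induced subgraph\<close>

lemma tanner_edge_iff [simp]:
  "{VNode v, CNode c} \<in> edges (tanner_graph H) \<longleftrightarrow> H $ c $ v = 1"
  by (auto simp: tanner_graph_def doubleton_eq_iff)

lemma ts_edge_iff [simp]:
  "{VNode v, CNode c} \<in> edges (ts_subgraph (tanner_graph H) S) \<longleftrightarrow> v \<in> nbrs H S c"
  by (auto simp: ts_subgraph_def induced_subgraph_def nbrs_def)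

lemma ts_edge_iff' [simp]:
  "{CNode c, VNode v} \<in> edges (ts_subgraph (tanner_graph H) S) \<longleftrightarrow> v \<in> nbrs H S c"
  by (subst insert_commute) simp

lemma tanner_edge_iff' [simp]:
  "{CNode c, VNode v} \<in> edges (tanner_graph H) \<longleftrightarrow> H $ c $ v = 1"
  by (subst insert_commute) simp

lemma ts_verts_VNode [simp]: "VNode v \<in> verts (ts_subgraph (tanner_graph H) S) \<longleftrightarrow> v \<in> S"
  by (auto simp: ts_subgraph_def induced_subgraph_def tanner_graph_def)

lemma ts_verts_CNode [simp]:
  "CNode c \<in> verts (ts_subgraph (tanner_graph H) S) \<longleftrightarrow> nbrs H S c \<noteq> {}"
proof -
  have "verts (tanner_graph H) = UNIV" by (simp add: tanner_graph_def)
  then show ?thesis by (auto simp: ts_subgraph_def induced_subgraph_def nbrs_def)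
qed

lemma degree_VNode: "degree (tanner_graph H) (VNode v) = card {c. H $ c $ v = 1}"
proof -
  have "{e \<in> edges (tanner_graph H). VNode v \<in> e} = (\<lambda>c. {VNode v, CNode c}) ` {c. H $ c $ v = 1}"
    by (auto simp: tanner_graph_def)
  moreover have "inj_on (\<lambda>c. {VNode v, CNode c}) {c. H $ c $ v = 1}"
    by (auto simp: inj_on_def doubleton_eq_iff)
  ultimately show ?thesis by (simp add: degree_def card_image)
qed

lemma degree_CNode [simp]:
  "degree (ts_subgraph (tanner_graph H) S) (CNode c) = card (nbrs H S c)"
proof -
  have "{e \<in> edges (ts_subgraph (tanner_graph H) S). CNode c \<in> e} =
      (\<lambda>v. {VNode v, CNode c}) ` nbrs H S c" (is "?L = ?R")
  proof
    show "?L \<subseteq> ?R"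
    proof
      fix e assume e: "e \<in> ?L"
      then obtain v d where "e = {VNode v, CNode d}"
        by (auto simp: ts_subgraph_def induced_subgraph_def tanner_graph_def)
      then show "e \<in> ?R" using e by auto
    qed
  qed auto
  moreover have "inj_on (\<lambda>v. {VNode v, CNode c}) (nbrs H S c)"
    by (auto simp: inj_on_def doubleton_eq_iff)
  ultimately show ?thesis by (simp add: degree_def card_image)
qed

lemma card_nbrs_nonempty_2:
  "nbrs H S c \<noteq> {} \<and> card (nbrs H S c) = 2 \<longleftrightarrow> card (nbrs H S c) = 2"
  by auto

lemma medges_vn_graph: "medges (vn_graph (tanner_graph H) S) = {c. card (nbrs H S c) = 2}"
  by (simp add: vn_graph_def card_nbrs_nonempty_2)

text \<open>Count the Tanner edges at \<open>S\<close> from both sides. Each v-node gives \<gamma>;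
  a c-node gives 0, 1 or 2, and those giving 1 are exactly the \<open>b\<close> c-nodes of odd
  degree.\<close>

lemma double_counting:
  assumes "\<And>v. degree (tanner_graph H) (VNode v) = \<gamma>"
    and "elementary_trapping_set (tanner_graph H) a b S"
  shows "a * \<gamma> = 2 * card {c. card (nbrs H S c) = 2} + b"
proof -
  let ?n = "\<lambda>c. card (nbrs H S c)"
  have a: "card S = a" "finite S"
    and b: "card {c. nbrs H S c \<noteq> {} \<and> odd (?n c)} = b"
    and el: "\<And>c. nbrs H S c \<noteq> {} \<Longrightarrow> ?n c = 1 \<or> ?n c = 2"
    using assms(2) by (auto simp: elementary_trapping_set_def trapping_set_def)
  have n: "?n c = (if ?n c = 2 then 2 else 0) + (if ?n c = 1 then 1 else 0)" for c
    using el[of c] by (cases "nbrs H S c = {}") auto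
  have "{c. nbrs H S c \<noteq> {} \<and> odd (?n c)} = {c. ?n c = 1}"
    using el by fastforce
  then have b': "b = card {c. ?n c = 1}" using b by simp
  have "a * \<gamma> = (\<Sum>v\<in>S. card {c. H $ c $ v = 1})"
    using a assms(1) by (simp add: degree_VNode)
  also have "\<dots> = (\<Sum>v\<in>S. \<Sum>c\<in>UNIV. if H $ c $ v = 1 then 1 else 0)"
    by (simp add: sum.If_cases)
  also have "\<dots> = (\<Sum>c\<in>UNIV. \<Sum>v\<in>S. if H $ c $ v = 1 then 1 else 0)"
    by (rule sum.swap)
  also have "\<dots> = (\<Sum>c\<in>UNIV. ?n c)"
    using a by (simp add: nbrs_def sum.If_cases Int_def)
  also have "\<dots> = (\<Sum>c\<in>UNIV. (if ?n c = 2 then 2 else 0) + (if ?n c = 1 then 1 else 0))"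
    using n by (rule sum.cong[OF refl])
  also have "\<dots> = 2 * card {c. ?n c = 2} + card {c. ?n c = 1}"
    by (simp add: sum.distrib sum.If_cases)
  finally show ?thesis using b' by simp
qed

section \<open>Consequences of the cycle conditions for the VN graph\<close>

lemma cycle_edges_subset_iff:
  "cycle_edges C \<subseteq> E \<longleftrightarrow> (\<forall>i < length C. {C ! i, C ! (Suc i mod length C)} \<in> E)"
  by (auto simp: cycle_edges_def)

text \<open>Two c-nodes with the same two ends would close a 4-cycle. Hence parallel edges are
  impossible, and edges of the VN graph can be counted as pairs of v-nodes.\<close>

lemma nbrs_inj:
  assumes no4: "\<not> (\<exists>C. is_cycle (tanner_graph H) C \<and> length C = 4)"
    and "card (nbrs H S c) = 2" "nbrs H S c = nbrs H S d"
  shows "c = d"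
proof (rule ccontr)
  assume "c \<noteq> d"
  obtain v w where vw: "nbrs H S c = {v, w}" "v \<noteq> w" using assms(2) by (auto simp: card_2_iff)
  then have in_N: "v \<in> nbrs H S c" "w \<in> nbrs H S c" "v \<in> nbrs H S d" "w \<in> nbrs H S d"
    using assms(3) by auto
  let ?C = "[VNode v, CNode c, VNode w, CNode d]"
  have "cycle_edges ?C \<subseteq> edges (tanner_graph H)"
    using in_N by (simp add: cycle_edges_subset_iff All_less_Suc nbrs_def)
  then have "is_cycle (tanner_graph H) ?C"
    using vw(2) \<open>c \<noteq> d\<close> by (simp add: is_cycle_def) (simp add: tanner_graph_def)
  moreover have "length ?C = 4" by simp
  ultimately show False using no4 by blast
qed

text \<open>The outer edges of the diamond form the 4-cycle w, x, z, y of the VN graph, hence an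
  8-cycle of the induced subgraph, and the c-node \<open>c\<close> of the diagonal is a chord of
  it.\<close>

lemma no_diamond:
  assumes chordless: "\<And>C. is_cycle (ts_subgraph (tanner_graph H) S) C \<Longrightarrow> length C = 8 \<Longrightarrow>
           chordless (ts_subgraph (tanner_graph H) S) C"
    and N: "nbrs H S c = {x, y}" "nbrs H S d1 = {w, x}" "nbrs H S d2 = {w, y}"
      "nbrs H S d3 = {z, x}" "nbrs H S d4 = {z, y}"
    and dist: "x \<noteq> y" "w \<noteq> x" "w \<noteq> y" "z \<noteq> x" "z \<noteq> y" "w \<noteq> z"
  shows False
proof -
  let ?G = "ts_subgraph (tanner_graph H) S"
  let ?C = "[VNode w, CNode d1, VNode x, CNode d3, VNode z, CNode d4, VNode y, CNode d2]"
  \<comment> \<open>The five c-nodes differ because their end sets do; this makes the 8-cycle a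
    genuine cycle and keeps \<open>c\<close> off it.\<close>
  have dist': "d1 \<noteq> d2" "d1 \<noteq> d3" "d1 \<noteq> d4" "d2 \<noteq> d3" "d2 \<noteq> d4" "d3 \<noteq> d4"
    "c \<noteq> d1" "c \<noteq> d2" "c \<noteq> d3" "c \<noteq> d4"
    using N dist by (auto simp: doubleton_eq_iff)
  have S: "w \<in> S" "x \<in> S" "y \<in> S" "z \<in> S" using N by (auto simp: nbrs_def)
  have "cycle_edges ?C \<subseteq> edges ?G"
    by (simp add: cycle_edges_subset_iff All_less_Suc N)
  then have "is_cycle ?G ?C" using dist dist' S N by (simp add: is_cycle_def)
  then have "chordless ?G ?C" by (rule chordless) simp
  then have "CNode c \<in> verts ?G \<and> CNode c \<notin> set ?C \<and> VNode x \<in> set ?C \<and> VNode y \<in> set ?C \<and>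
      x \<noteq> y \<longrightarrow> \<not> ({VNode x, CNode c} \<in> edges ?G \<and> {VNode y, CNode c} \<in> edges ?G)"
    unfolding chordless_def by blast
  then show False using dist(1) dist'(7-10) N(1) by simp
qed

lemma card_medges_vn_graph:
  fixes H :: "bit ^ 'n ^ 'm"
  assumes no4: "\<not> (\<exists>C. is_cycle (tanner_graph H) C \<and> length C = 4)"
    and chordless: "\<And>C. is_cycle (ts_subgraph (tanner_graph H) S) C \<Longrightarrow> length C = 8 \<Longrightarrow>
           chordless (ts_subgraph (tanner_graph H) S) C"
  shows "4 * card {c. card (nbrs H S c) = 2} \<le> card S ^ 2 + (if card S = 3 then 3 else 0)"
proof -
  let ?M = "{c. card (nbrs H S c) = 2}"
  let ?E = "nbrs H S ` ?M"
  have "inj_on (nbrs H S) ?M" using nbrs_inj[OF no4] by (auto simp: inj_on_def)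
  then have card: "card ?E = card ?M" by (rule card_image)
  have E: "e \<subseteq> S \<and> card e = 2" if "e \<in> ?E" for e using that by (auto simp: nbrs_def)
  have "4 * card ?E \<le> card S ^ 2 + (if card S = 3 then 3 else 0)"
  proof (rule card_edges_diamond_free)
    show "finite S" by simp
    fix w x y z
    assume "w \<noteq> z" and e: "{x, y} \<in> ?E" "{w, x} \<in> ?E" "{w, y} \<in> ?E" "{z, x} \<in> ?E" "{z, y} \<in> ?E"
    have "x \<noteq> y" "w \<noteq> x" "w \<noteq> y" "z \<noteq> x" "z \<noteq> y" using e[THEN E] by auto
    moreover obtain c d1 d2 d3 d4 where "{x, y} = nbrs H S c" "{w, x} = nbrs H S d1"
      "{w, y} = nbrs H S d2" "{z, x} = nbrs H S d3" "{z, y} = nbrs H S d4"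
      using e by (elim imageE)
    ultimately show False
      using no_diamond[OF chordless, of c x y d1 w d2 d3 z d4] \<open>w \<noteq> z\<close> by simp
  qed (rule E)
  then show ?thesis using card by simp
qed

theorem theorem2:
  fixes H :: "bit ^ 'n ^ 'm" and S :: "'n set" and \<gamma> a b :: nat
  assumes "\<gamma> \<ge> 1"
    and "\<And>v. degree (tanner_graph H) (VNode v) = \<gamma>"
    and "\<not> (\<exists>C. is_cycle (tanner_graph H) C \<and> length C = 4)"
    and "elementary_trapping_set (tanner_graph H) a b S"
    and "\<And>C. is_cycle (ts_subgraph (tanner_graph H) S) C \<Longrightarrow> length C = 8 \<Longrightarrow>
           chordless (ts_subgraph (tanner_graph H) S) C"
  shows "real (card (medges (vn_graph (tanner_graph H) S))) \<le> real a ^ 3 / (4 * real a - 3) \<and>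
         real b \<ge> real a * real \<gamma> - 2 * real a ^ 3 / (4 * real a - 3) \<and>
         (b < a \<longrightarrow> real a \<ge> 2 * real \<gamma> - 2)"
proof -
  define k where "k = card {c. card (nbrs H S c) = 2}"
  have a: "card S = a" "a \<ge> 1"
    using assms(4) by (auto simp: elementary_trapping_set_def trapping_set_def)
  have count: "a * \<gamma> = 2 * k + b" unfolding k_def by (rule double_counting[OF assms(2,4)])
  have k: "4 * k \<le> a ^ 2 + (if a = 3 then 3 else 0)"
    using card_medges_vn_graph[OF assms(3,5)] a k_def by simp
  have bound: "real k \<le> real a ^ 3 / (4 * real a - 3)"
  \<comment> \<open>For a = 3 the bound is attained: k \<le> 3 = 27/9. Otherwise k \<le> a^2/4, and
    a^2/4 * (4a - 3) = a^3 - 3a^2/4 \<le> a^3.\<close>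
  proof (cases "a = 3")
    case True
    then show ?thesis using k by simp
  next
    case False
    then have "real (4 * k) \<le> real (a ^ 2)" using k by (intro of_nat_mono) simp
    then have "real k * (4 * real a - 3) \<le> real a ^ 2 / 4 * (4 * real a - 3)"
      using a(2) by (intro mult_right_mono) auto
    also have "\<dots> \<le> real a ^ 3" by (simp add: power2_eq_square power3_eq_cube field_simps)
    finally show ?thesis using a(2) by (simp add: pos_le_divide_eq)
  qed
  have "real b = real a * real \<gamma> - 2 * real k"
    using arg_cong[OF count, of real] by simp
  then have b: "real b \<ge> real a * real \<gamma> - 2 * real a ^ 3 / (4 * real a - 3)"
    using bound by simp
  have "2 * \<gamma> \<le> a + 2" if "b < a"
  \<comment> \<open>For a = 3, 3\<gamma> = 2k + b \<le> 6 + 2 gives \<gamma> \<le> 2. Otherwise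
    2a\<gamma> = 4k + 2b < a^2 + 2a, and cancelling \<open>a\<close> even gives a strict
    inequality.\<close>
  proof (cases "a = 3")
    case True
    then show ?thesis using k count that by simp
  next
    case False
    then have "4 * k \<le> a * a" using k by (simp add: power2_eq_square)
    then have "a * (2 * \<gamma>) < a * (a + 2)" using count that by (simp add: algebra_simps)
    then show ?thesis unfolding mult_less_cancel1 by linarith
  qed
  then have "b < a \<longrightarrow> real a \<ge> 2 * real \<gamma> - 2" by linarith
  then show ?thesis using bound b by (simp add: medges_vn_graph k_def)
qed

end
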